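(* The quasi-Assouad and Assouad dimensions of the popcorn graph $G_f$ and the full popcorn set $F$ satisfy $\dim_{qA} G_f=\dim_{qA}F=\dim_A G_f=\dim_A F=2$.
   Context: The popcorn function $f:[0,1]\to\mathbb{R}$ is defined by $f(x)=1/q$ if $x=p/q$ with $\gcd(p,q)=1$ and $1\le p<q$ integers, and $f(x)=0$ otherwise. The popcorn graph is $G_f=\{(x,f(x)) : x\in[0,1]\}\subset\mathbb{R}^2$. The full popcorn set is $F=\{(p/q,1/q): p,q \text{ positive integers with } p<q\}\cup([0,1]\times\{0\})$. For a bounded set $X\subset\mathbb{R}^d$ and $\delta>0$, $N_\delta(X)$ denotes the smallest number of closed cubes of side length $\delta$ needed to cover $X$ (with $N_\delta(\emptyset)=0$). For $x=(x_1,\dots,x_d)\in\mathbb{R}^d$ and $R>0$ write $C(x,R)=[x_1,x_1+R]\times\dots\times[x_d,x_d+R]$. The Assouad dimension of a non-empty set $X\subset\mathbb{R}^d$ is $$\dim_A X=\inf\{s\ge0:\text{there is } c>0 \text{ such that for all } 0<r<R \text{ and all } x\in\mathbb{R}^d,\ N_r(C(x,R)\cap X)\le c\,(R/r)^s\}.$$ The quasi-Assouad dimension of a non-empty bounded set $X$ is $\dim_{qA}X=\lim_{\theta\to1^-}h_X(\theta)$, where for $0<\theta<1$ $$h_X(\theta)=\inf\{s\ge0:\text{there is } c>0 \text{ such that for all } 0<R<1,\ 0<r\le R^{1/\theta} \text{ and all } x\in\mathbb{R}^d,\ N_r(C(x,R)\cap X)\le c\,(R/r)^s\}.$$ Equivalently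 (a known fact), $\dim_{qA}X=\lim_{\theta\to1^-}\dim_A^\theta X$, where the Assouad spectrum $\dim_A^\theta X$ is defined as $h_X(\theta)$ but using only $r=R^{1/\theta}$. *)

theory Defs
  imports "HOL-Analysis.Analysis"
begin

text \<open>The closed axis-parallel cube \<open>C(x,R)\<close> with lower corner \<open>x\<close> and side length \<open>R\<close>;
  \<open>One\<close> is the all-ones vector.\<close>

definition cube :: "'a::euclidean_space \<Rightarrow> real \<Rightarrow> 'a set" where
  "cube x R = cbox x (x + R *\<^sub>R One)"

text \<open>Only meaningful for bounded \<open>X\<close> and \<open>\<delta> > 0\<close>, where a finite cover exists.\<close>

definition covering_number :: "real \<Rightarrow> 'a::euclidean_space set \<Rightarrow> nat" where
  "covering_number \<delta> X =
     (LEAST n. \<exists>\<C>. finite \<C> \<and> card \<C> = n \<and> (\<forall>C\<in>\<C>. \<exists>x. C = cube x \<delta>) \<and> X \<subseteq> \<Union>\<C>)"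

text \<open>In dimension \<open>d\<close> the exponent \<open>s = d\<close> is always admissible, so the infima below are taken over
  nonempty sets of nonnegative reals.\<close>

definition assouad_dim :: "'a::euclidean_space set \<Rightarrow> real" where
  "assouad_dim X =
     Inf {s. 0 \<le> s \<and> (\<exists>c>0. \<forall>r R x. 0 < r \<and> r < R \<longrightarrow>
            real (covering_number r (cube x R \<inter> X)) \<le> c * (R / r) powr s)}"

definition quasi_assouad_h :: "'a::euclidean_space set \<Rightarrow> real \<Rightarrow> real" where
  "quasi_assouad_h X \<theta> =
     Inf {s. 0 \<le> s \<and> (\<exists>c>0. \<forall>r R x. 0 < R \<and> R < 1 \<and> 0 < r \<and> r \<le> R powr (1 / \<theta>) \<longrightarrow>
            real (covering_number r (cube x R \<inter> X)) \<le> c * (R / r) powr s)}"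

text \<open>The limit exists because \<open>quasi_assouad_h X\<close> is monotone and bounded on \<open>(0,1)\<close>.\<close>

definition quasi_assouad_dim :: "'a::euclidean_space set \<Rightarrow> real" where
  "quasi_assouad_dim X = Lim (at_left 1) (quasi_assouad_h X)"

definition popcorn_rep :: "real \<Rightarrow> nat \<Rightarrow> nat \<Rightarrow> bool" where
  "popcorn_rep x p q \<longleftrightarrow> coprime p q \<and> 1 \<le> p \<and> p < q \<and> x = real p / real q"

text \<open>The denominator in lowest terms is unique, so \<open>THE\<close> is well defined; see the lemma below.\<close>

definition popcorn :: "real \<Rightarrow> real" where
  "popcorn x = (if \<exists>p q. popcorn_rep x p q then 1 / real (THE q. \<exists>p. popcorn_rep x p q) else 0)"

lemma popcorn_eq:
  assumes "popcorn_rep x p q"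
  shows "popcorn x = 1 / real q"
proof -
  have "q' = q" if "popcorn_rep x p' q'" for p' q'
  proof -
    have "real p' * real q = real p * real q'" 
      using assms that unfolding popcorn_rep_def by (auto simp: field_simps)
    then have eq: "p' * q = p * q'"
      by (metis of_nat_eq_iff of_nat_mult)
    have "q' dvd q"
      using that eq unfolding popcorn_rep_def
      by (metis coprime_commute coprime_dvd_mult_right_iff dvd_triv_right)
    moreover have "q dvd q'"
      using assms eq unfolding popcorn_rep_def
      by (metis coprime_commute coprime_dvd_mult_right_iff dvd_triv_right)
    ultimately show ?thesis by (rule dvd_antisym)
  qed
  with assms have "(THE q. \<exists>p. popcorn_rep x p q) = q" by blast
  with assms show ?thesis unfolding popcorn_def by auto
qed

definition popcorn_graph :: "(real \<times> real) set" where
  "popcorn_graph = {(x, popcorn x) | x. x \<in> {0..1}}"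

definition full_popcorn_set :: "(real \<times> real) set" where
  "full_popcorn_set =
     {(real p / real q, 1 / real q) | p q :: nat. 0 < p \<and> 0 < q \<and> p < q} \<union> {0..1} \<times> {0}"

end

(*
  The set lies in the plane, so 2 is always an admissible exponent. For the lower bound fix a large
  integer b and look at the graph near (1/b, 1/b^2). A fraction p/q with q = p*b - j satisfies
  p/q - 1/b = j/(b*q), so the points (p/q, 1/q) lie on lines through (1/b, 0) indexed by j, and
  on each line the denominators advance by b. For b < p <= 2*b and 1 <= j <= b these points form a
  slightly distorted b x b grid of mesh about b^-3 inside a square of side R = b^-2. At least b^2/8
  of the pairs (p, j) are coprime, and then p/q is reduced; squares of side r = b^-3/5 contain at
  most one grid point each. Hence N_r >= (R/r)^2/200, while r <= R^(1/theta) as soon as theta >= 2/3.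
*)
theory Submission
  imports Defs
begin

section \<open>Cubes and covering numbers\<close>

lemma mem_cube_iff:
  "y \<in> cube x R \<longleftrightarrow> (\<forall>i\<in>Basis. x \<bullet> i \<le> y \<bullet> i \<and> y \<bullet> i \<le> x \<bullet> i + R)"
  by (auto simp: cube_def mem_box inner_add_left inner_sum_left inner_Basis if_distrib
      cong: if_cong)

lemma mem_cube_prod_iff:
  fixes a b u v :: real
  shows "(u, v) \<in> cube (a, b) R \<longleftrightarrow> a \<le> u \<and> u \<le> a + R \<and> b \<le> v \<and> v \<le> b + R"
proof -
  have Basis_eq: "Basis = {(1, 0), (0, 1) :: real \<times> real}"
    by (auto simp: Basis_prod_def)
  show ?thesis
    unfolding mem_cube_iff Basis_eq by auto
qed

text \<open>The cover is the grid of translates with corners \<open>x + r * f\<close>, where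
  \<open>f\<close> runs over the functions from the basis to \<open>{..<n}\<close>; each point is
  located in the grid coordinate by coordinate.\<close>

lemma cube_grid_cover:
  fixes x :: "'a::euclidean_space"
  assumes "0 < r" "R \<le> real n * r" "0 < n"
  shows "\<exists>\<C>. finite \<C> \<and> card \<C> \<le> n ^ DIM('a) \<and> (\<forall>C\<in>\<C>. \<exists>y. C = cube y r) \<and> cube x R \<subseteq> \<Union>\<C>"
proof -
  define corner where "corner f = x + (\<Sum>i\<in>Basis. (real (f i) * r) *\<^sub>R i)" for f :: "'a \<Rightarrow> nat"
  define I where "I = (Basis :: 'a set) \<rightarrow>\<^sub>E {..<n}"
  have fin: "finite I"
    unfolding I_def by (intro finite_PiE) auto
  have corner_inner: "corner f \<bullet> i = x \<bullet> i + real (f i) * r" if "i \<in> Basis" for f i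
    using that by (simp add: corner_def inner_add_left)
  have "card ((\<lambda>f. cube (corner f) r) ` I) \<le> card I"
    by (rule card_image_le[OF fin])
  also have "card I = n ^ DIM('a)"
    by (simp add: I_def card_PiE)
  finally have card: "card ((\<lambda>f. cube (corner f) r) ` I) \<le> n ^ DIM('a)" .
  have "\<exists>f\<in>I. y \<in> cube (corner f) r" if y: "y \<in> cube x R" for y
  proof -
    have "\<exists>k<n. x \<bullet> i + real k * r \<le> y \<bullet> i \<and> y \<bullet> i \<le> x \<bullet> i + real k * r + r"
      if i: "i \<in> Basis" for i
    proof -
      define t where "t = (y \<bullet> i - x \<bullet> i) / r"
      have t0: "0 \<le> t" and tn: "t \<le> real n" and yt: "y \<bullet> i = x \<bullet> i + t * r"
        using y i assms by (auto simp: t_def mem_cube_iff field_simps dest!: bspec[of _ _ i])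
      \<comment> \<open>The floor alone fails at the far face: for \<open>t = n\<close> it gives
        \<open>n\<close>, while the last cell has index \<open>n - 1\<close>.\<close>
      define k where "k = min (nat \<lfloor>t\<rfloor>) (n - 1)"
      have "k < n" "real k \<le> t" "t \<le> real k + 1"
        using t0 tn \<open>0 < n\<close> unfolding k_def min_def by (auto split: if_splits) linarith+
      moreover have "real k * r \<le> t * r" "t * r \<le> (real k + 1) * r"
        using calculation \<open>0 < r\<close> by (auto intro: mult_right_mono)
      ultimately show ?thesis
        by (intro exI[of _ k]) (simp add: yt distrib_right)
    qed
    then obtain k where k: "\<And>i. i \<in> Basis \<Longrightarrow> k i < n \<and> x \<bullet> i + real (k i) * r \<le> y \<bullet> i \<and>
        y \<bullet> i \<le> x \<bullet> i + real (k i) * r + r"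
      by metis
    then have "restrict k Basis \<in> I" "y \<in> cube (corner (restrict k Basis)) r"
      by (auto simp: I_def mem_cube_iff corner_inner)
    then show ?thesis by blast
  qed
  then show ?thesis
    using card fin by (intro exI[of _ "(\<lambda>f. cube (corner f) r) ` I"]) auto
qed

lemma covering_number_le:
  assumes "finite \<C>" "\<forall>C\<in>\<C>. \<exists>y. C = cube y r" "X \<subseteq> \<Union>\<C>"
  shows "covering_number r X \<le> card \<C>"
  unfolding covering_number_def
  by (rule Least_le, rule exI[of _ \<C>]) (intro conjI refl assms)

text \<open>This makes the exponent \<open>DIM('a)\<close> admissible for every \<open>X\<close>.
  Since \<open>R / r > 1\<close>, its ceiling is at most \<open>2 * (R / r)\<close>, which yields
  the constant \<open>2 ^ DIM('a)\<close>.\<close>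

lemma covering_number_cube_le:
  fixes x :: "'a::euclidean_space"
  assumes "0 < r" "r < R"
  shows "real (covering_number r (cube x R \<inter> X)) \<le> 2 ^ DIM('a) * (R / r) powr real DIM('a)"
proof -
  define n where "n = nat \<lceil>R / r\<rceil>"
  have "1 < R / r"
    using assms by simp
  then have n: "0 < n" "R / r \<le> real n" "real n \<le> 2 * (R / r)"
    unfolding n_def by linarith+
  then have "R \<le> real n * r"
    using assms by (simp add: field_simps)
  from cube_grid_cover[OF assms(1) this n(1), of x]
  obtain \<C> where \<C>: "finite \<C>" "card \<C> \<le> n ^ DIM('a)" "\<forall>C\<in>\<C>. \<exists>y. C = cube y r" "cube x R \<subseteq> \<Union>\<C>"
    by (elim exE conjE) (rule that)
  have "covering_number r (cube x R \<inter> X) \<le> card \<C>"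
    using \<C> by (intro covering_number_le le_infI1)
  then have "covering_number r (cube x R \<inter> X) \<le> n ^ DIM('a)"
    using \<C>(2) by (rule order_trans)
  then have "real (covering_number r (cube x R \<inter> X)) \<le> real n ^ DIM('a)"
    by (simp flip: of_nat_power)
  also have "\<dots> \<le> (2 * (R / r)) ^ DIM('a)"
    using n by (intro power_mono) auto
  also have "\<dots> = 2 ^ DIM('a) * (R / r) powr real DIM('a)"
    using assms by (simp add: power_mult_distrib powr_realpow del: times_divide_eq_right)
  finally show ?thesis .
qed

text \<open>A cube of side \<open>r\<close> holds at most one point of \<open>A\<close>, so choosing
  a covering cube for each point is injective into any cover, in particular into a minimal
  one.\<close>

lemma card_le_covering_number_cube:
  fixes x :: "'a::euclidean_space"
  assumes "0 < r" and A: "A \<subseteq> cube x R \<inter> X"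
    and sep: "\<And>y u v. u \<in> A \<Longrightarrow> v \<in> A \<Longrightarrow> u \<in> cube y r \<Longrightarrow> v \<in> cube y r \<Longrightarrow> u = v"
  shows "card A \<le> covering_number r (cube x R \<inter> X)"
proof -
  let ?P = "\<lambda>n \<C>. finite \<C> \<and> card \<C> = n \<and> (\<forall>C\<in>\<C>. \<exists>y. C = cube y r) \<and> cube x R \<inter> X \<subseteq> \<Union>\<C>"
  \<comment> \<open>The \<open>LEAST\<close> in \<open>covering_number\<close> is attained only if
    some finite cover exists, so a grid cover is produced first. The maximum with 1 keeps
    \<open>n\<close> positive for every \<open>R\<close>.\<close>
  define n where "n = nat \<lceil>max 1 (R / r)\<rceil>"
  have "0 < n" "R / r \<le> real n"
    unfolding n_def by linarith+
  then have "R \<le> real n * r"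
    using assms by (simp add: field_simps)
  then obtain \<D> where "finite \<D>" "\<forall>C\<in>\<D>. \<exists>y. C = cube y r" "cube x R \<subseteq> \<Union>\<D>"
    using cube_grid_cover[OF assms(1) _ \<open>0 < n\<close>, of R x] by blast
  then have "?P (card \<D>) \<D>"
    by auto
  then have "\<exists>n \<C>. ?P n \<C>"
    by (intro exI)
  then have "\<exists>\<C>. ?P (covering_number r (cube x R \<inter> X)) \<C>"
    unfolding covering_number_def by (rule LeastI_ex)
  then obtain \<C> where fin: "finite \<C>" and card: "card \<C> = covering_number r (cube x R \<inter> X)"
    and cubes: "\<forall>C\<in>\<C>. \<exists>y. C = cube y r" and cover: "cube x R \<inter> X \<subseteq> \<Union>\<C>"
    by blast
  have "\<forall>u\<in>A. \<exists>C\<in>\<C>. u \<in> C"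
    using A cover by blast
  then obtain F where F: "\<And>u. u \<in> A \<Longrightarrow> F u \<in> \<C> \<and> u \<in> F u"
    by metis
  have "inj_on F A"
    using F cubes sep by (intro inj_onI) metis
  then have "card A \<le> card \<C>"
    using F fin by (intro card_inj_on_le[of F]) auto
  then show ?thesis
    by (simp add: card)
qed

section \<open>Counting coprime pairs\<close>

lemma sum_inverse_squares_le:
  assumes "2 \<le> n"
  shows "(\<Sum>d=2..n. 1 / real d ^ 2) \<le> 3/4 - 1 / real n"
  using assms
proof (induction n rule: nat_induct_at_least)
  case base
  then show ?case by simp
next
  case (Suc n)
  \<comment> \<open>Telescoping: the term \<open>- 1 / real n\<close> in the claim exists to absorb
    this step, and at \<open>n = 2\<close> the claim is an equality.\<close>
  have "1 / real (Suc n) ^ 2 \<le> 1 / real n - 1 / real (Suc n)"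
    using Suc.hyps by (simp add: divide_simps power2_eq_square)
  then show ?case
    using Suc by simp
qed

text \<open>The window may start anywhere relative to the multiples of \<open>d\<close>, which costs
  the rounding term 1.\<close>

lemma card_multiples_le:
  assumes "0 < d"
  shows "real (card {m\<in>{a<..a+n}. d dvd m}) \<le> real n / real d + 1"
proof -
  have "{m\<in>{a<..a+n}. d dvd m} \<subseteq> (\<lambda>k. d * k) ` {a div d<..(a+n) div d}"
  proof
    fix m assume "m \<in> {m\<in>{a<..a+n}. d dvd m}"
    then obtain k where "m = d * k" "a < d * k" "d * k \<le> a + n"
      by auto
    moreover have "a div d < k" "k \<le> (a + n) div d"
      using calculation assms
      by (simp_all add: less_mult_imp_div_less less_eq_div_iff_mult_less_eq mult.commute)
    ultimately show "m \<in> (\<lambda>k. d * k) ` {a div d<..(a+n) div d}"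
      by auto
  qed
  then have "card {m\<in>{a<..a+n}. d dvd m} \<le> card {a div d<..(a+n) div d}"
    by (rule surj_card_le[rotated]) simp
  then have "real (card {m\<in>{a<..a+n}. d dvd m}) \<le> real ((a+n) div d - a div d)"
    by simp
  also have "\<dots> = real ((a+n) div d) - real (a div d)"
    by (simp add: of_nat_diff div_le_mono)
  also have "\<dots> \<le> real n / real d + 1"
  proof -
    have "real ((a+n) div d) \<le> real (a+n) / real d"
      by (rule of_nat_div_le_of_nat)
    moreover have "real a / real d \<le> real (a div d) + 1"
      using floor_divide_of_nat_eq[of a d, where ?'a = real] by linarith
    ultimately show ?thesis
      by (simp add: add_divide_distrib)
  qed
  finally show ?thesis .
qed

text \<open>There is no rounding term because the window starts just after the multiple 0; the
  product of the two counts then has no constant term. For \<open>d = 0\<close> both sides are 0, by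
  the convention for division by zero.\<close>

lemma card_multiples_atLeast1:
  "real (card {m\<in>{1..n}. d dvd m}) \<le> real n / real d"
proof (cases "d = 0")
  case False
  have "{m\<in>{1..n}. d dvd m} \<subseteq> (\<lambda>k. d * k) ` {1..n div d}"
  proof
    fix m assume "m \<in> {m\<in>{1..n}. d dvd m}"
    then obtain k where "m = d * k" "1 \<le> d * k" "d * k \<le> n"
      by auto
    moreover have "1 \<le> k" "k \<le> n div d"
      using calculation False
      by (auto simp: less_eq_div_iff_mult_less_eq mult.commute intro: Suc_leI gr0I)
    ultimately show "m \<in> (\<lambda>k. d * k) ` {1..n div d}"
      by auto
  qed
  then have "card {m\<in>{1..n}. d dvd m} \<le> card {1..n div d}"
    by (rule surj_card_le[rotated]) simp
  then have "real (card {m\<in>{1..n}. d dvd m}) \<le> real (n div d)"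
    by simp
  also have "\<dots> \<le> real n / real d"
    by (rule of_nat_div_le_of_nat)
  finally show ?thesis .
qed (auto simp: Collect_conv_if)

definition coprime_pairs :: "nat \<Rightarrow> (nat \<times> nat) set" where
  "coprime_pairs b = {(p, j) \<in> {b<..b+b} \<times> {1..b}. coprime p j}"

text \<open>Pairs with a common divisor \<open>d \<ge> 2\<close> number at most \<open>b\<^sup>2/d\<^sup>2 + b/d\<close>, and
  \<open>\<Sum>d\<ge>2. 1/d\<^sup>2 \<le> 3/4\<close>; the linear terms are absorbed via \<open>1/d \<le> 4/d\<^sup>2 + 1/16\<close>.\<close>

lemma card_coprime_pairs:
  assumes b: "48 \<le> b"
  shows "real b ^ 2 / 8 \<le> real (card (coprime_pairs b))"
proof -
  let ?box = "{b<..b+b} \<times> {1..b}"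
  let ?bad = "\<lambda>d. {p\<in>{b<..b+b}. d dvd p} \<times> {j\<in>{1..b}. d dvd j}"
  let ?S = "\<Sum>d=2..b. 1 / real d ^ 2"
  have "?box \<subseteq> coprime_pairs b \<union> (\<Union>d\<in>{2..b}. ?bad d)"
  proof
    fix z assume z: "z \<in> ?box"
    obtain p j where pj: "z = (p, j)" by (cases z)
    show "z \<in> coprime_pairs b \<union> (\<Union>d\<in>{2..b}. ?bad d)"
    proof (cases "coprime p j")
      case True
      then show ?thesis using z pj by (auto simp: coprime_pairs_def)
    next
      case False
      \<comment> \<open>The gcd of a bad pair is itself an index of the union: it is at most
        \<open>j\<close>, hence at most \<open>b\<close>, so divisors above \<open>b\<close> never
        occur.\<close>
      have "gcd p j \<le> j"
        using z pj by (intro gcd_le2_nat) auto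
      moreover have "j \<le> b" "gcd p j \<noteq> 0" "gcd p j \<noteq> 1"
        using z pj False by (auto simp: coprime_iff_gcd_eq_1 simp del: One_nat_def)
      ultimately have "gcd p j \<in> {2..b}"
        unfolding atLeastAtMost_iff by linarith
      moreover have "z \<in> ?bad (gcd p j)"
        using z pj by auto
      ultimately show ?thesis by blast
    qed
  qed
  then have "card ?box \<le> card (coprime_pairs b \<union> (\<Union>d\<in>{2..b}. ?bad d))"
    by (rule card_mono[rotated]) (auto simp: coprime_pairs_def intro: finite_subset[of _ ?box])
  also have "\<dots> \<le> card (coprime_pairs b) + card (\<Union>d\<in>{2..b}. ?bad d)"
    by (rule card_Un_le)
  also have "\<dots> \<le> card (coprime_pairs b) + (\<Sum>d=2..b. card (?bad d))"
    by (intro add_left_mono card_UN_le) simp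
  finally have "b ^ 2 \<le> card (coprime_pairs b) + (\<Sum>d=2..b. card (?bad d))"
    by (simp add: power2_eq_square)
  then have "real (b ^ 2) \<le> real (card (coprime_pairs b) + (\<Sum>d=2..b. card (?bad d)))"
    by (simp only: of_nat_le_iff)
  then have "real b ^ 2 \<le> real (card (coprime_pairs b)) + (\<Sum>d=2..b. real (card (?bad d)))"
    by simp
  moreover have "(\<Sum>d=2..b. real (card (?bad d))) \<le>
      (\<Sum>d=2..b. (real b ^ 2 + 4 * real b) * (1 / real d ^ 2) + real b / 16)"
  proof (rule sum_mono)
    fix d assume "d \<in> {2..b}"
    then have d: "0 < d" by simp
    have "real (card (?bad d)) =
        real (card {p\<in>{b<..b+b}. d dvd p}) * real (card {j\<in>{1..b}. d dvd j})"
      by (simp add: card_cartesian_product)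
    also have "\<dots> \<le> (real b / real d + 1) * (real b / real d)"
      by (intro mult_mono card_multiples_le[OF d] card_multiples_atLeast1) auto
    also have "\<dots> = real b ^ 2 / real d ^ 2 + real b * (1 / real d)"
      by (simp add: power2_eq_square algebra_simps)
    also have "\<dots> \<le> real b ^ 2 / real d ^ 2 + real b * (4 / real d ^ 2 + 1/16)"
    proof -
      have "0 \<le> (2 / real d - 1/4) ^ 2" by simp
      then have "1 / real d \<le> 4 / real d ^ 2 + 1/16"
        by (simp add: power2_diff power_divide)
      then show ?thesis
        by (intro add_left_mono mult_left_mono) auto
    qed
    finally show "real (card (?bad d)) \<le> (real b ^ 2 + 4 * real b) * (1 / real d ^ 2) + real b / 16"
      by (simp add: algebra_simps add_divide_distrib)
  qed
  moreover have "(\<Sum>d=2..b. (real b ^ 2 + 4 * real b) * (1 / real d ^ 2) + real b / 16) =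
      (real b ^ 2 + 4 * real b) * ?S + real (b - 1) * (real b / 16)"
    by (simp add: sum.distrib sum_distrib_left)
  moreover have "(real b ^ 2 + 4 * real b) * ?S \<le> (real b ^ 2 + 4 * real b) * (3/4)"
  proof -
    have "0 \<le> 1 / real b" by simp
    then have "?S \<le> 3/4"
      using sum_inverse_squares_le[of b] b by linarith
    then show ?thesis
      by (intro mult_left_mono) auto
  qed
  moreover have "real (b - 1) * (real b / 16) \<le> real b * (real b / 16)"
    by (intro mult_right_mono) auto
  \<comment> \<open>The bounds so far leave at least
    \<open>b^2 - 3/4 * (b^2 + 4*b) - b^2/16 = 3/16 * b^2 - 3*b\<close> coprime pairs. This is at
    least \<open>b^2/8\<close> exactly when \<open>b \<ge> 48\<close>.\<close>
  moreover have "48 * real b \<le> real b ^ 2"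
    using b by (simp add: power2_eq_square)
  ultimately show ?thesis
    by (simp add: algebra_simps power2_eq_square)
qed

section \<open>The grid of popcorn points near \<open>1 / b\<close>\<close>

text \<open>The denominator is a difference of reals, so that field arithmetic applies without
  truncation; \<open>popcorn_point_in_graph\<close> matches it with the natural number
  \<open>p * b - j\<close>.\<close>

definition popcorn_point :: "nat \<Rightarrow> nat \<times> nat \<Rightarrow> real \<times> real" where
  "popcorn_point b = (\<lambda>(p, j). (real p / (real p * real b - real j), 1 / (real p * real b - real j)))"

text \<open>Starting at \<open>p = b + 1\<close> makes \<open>p * b\<close> exceed
  \<open>b^2\<close> by at least \<open>b\<close>, which absorbs \<open>j\<close>. All heights thus
  lie between \<open>1 / (2 * b^2)\<close> and \<open>1 / b^2\<close>.\<close>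

lemma denominator_bounds:
  assumes "(p, j) \<in> coprime_pairs b"
  shows "real b ^ 2 \<le> real p * real b - real j" "real p * real b - real j \<le> 2 * real b ^ 2"
proof -
  have pj: "b + 1 \<le> p" "p \<le> 2 * b" "j \<le> b"
    using assms by (auto simp: coprime_pairs_def)
  have "(real b + 1) * real b \<le> real p * real b" "real p * real b \<le> 2 * real b * real b"
    using pj by (intro mult_right_mono; simp)+
  then have "real b * real b + real b \<le> real p * real b" "real p * real b \<le> 2 * (real b * real b)"
    by (simp_all only: distrib_right mult_1 mult.assoc)
  moreover have "0 \<le> real j" "real j \<le> real b"
    using pj by simp_all
  ultimately show "real b ^ 2 \<le> real p * real b - real j" "real p * real b - real j \<le> 2 * real b ^ 2"
    unfolding power2_eq_square by linarith+
qed

text \<open>A common divisor of \<open>p\<close> and \<open>p * b - j\<close> also divides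
  \<open>j\<close>, so coprimality of \<open>p\<close> and \<open>j\<close> makes the fraction
  reduced.\<close>

lemma popcorn_point_in_graph:
  assumes b: "3 \<le> b" and pj: "(p, j) \<in> coprime_pairs b"
  shows "popcorn_point b (p, j) \<in> popcorn_graph"
proof -
  have cop: "coprime p j" and "1 \<le> p" "j \<le> b" "b < p"
    using pj by (auto simp: coprime_pairs_def)
  \<comment> \<open>Since \<open>j \<le> b < p\<close>, the denominator exceeds
    \<open>3 * p - p\<close>; hence the fraction is below 1 and the subtraction does not
    truncate.\<close>
  have "p * 3 \<le> p * b"
    using b by simp
  then have le: "j \<le> p * b" and lt: "p < p * b - j"
    using \<open>j \<le> b\<close> \<open>b < p\<close> by linarith+
  have "coprime p (p * b - j)"
    unfolding coprime_def
  proof (intro allI impI)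
    fix c assume c: "c dvd p" "c dvd p * b - j"
    then have "c dvd p * b - (p * b - j)"
      by (blast intro: dvd_diff_nat[OF dvd_mult2])
    then show "is_unit c"
      using c le cop by (simp add: coprime_def)
  qed
  then have rep: "popcorn_rep (real p / real (p * b - j)) p (p * b - j)"
    using \<open>1 \<le> p\<close> lt by (simp add: popcorn_rep_def)
  have "popcorn_point b (p, j) = (real p / real (p * b - j), popcorn (real p / real (p * b - j)))"
    unfolding popcorn_eq[OF rep] using le by (simp add: popcorn_point_def of_nat_diff)
  moreover have "real p / real (p * b - j) \<in> {0..1}"
    using lt by (simp del: of_nat_diff)
  ultimately show ?thesis
    unfolding popcorn_graph_def by blast
qed

text \<open>With \<open>q\<close> the denominator, divide \<open>p * b = q + j\<close> by
  \<open>b * q\<close>. For fixed \<open>j\<close> the abscissa is affine in the height.\<close>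

lemma popcorn_point_fst:
  assumes "0 < b" "(p, j) \<in> coprime_pairs b"
  shows "fst (popcorn_point b (p, j)) = 1 / real b + real j / real b * snd (popcorn_point b (p, j))"
proof -
  have "0 < real p * real b - real j"
    using denominator_bounds(1)[OF assms(2)] assms(1) by (smt (verit) of_nat_0_less_iff zero_less_power)
  then show ?thesis
    using assms(1) by (simp add: popcorn_point_def field_simps)
qed

text \<open>The lower corner sits at the least possible height. The horizontal offset from
  \<open>1 / b\<close> is \<open>j / b\<close> times the height, hence at most the height, which is
  at most \<open>1 / b^2\<close>.\<close>

lemma popcorn_point_in_cube:
  assumes b: "0 < b" and pj: "(p, j) \<in> coprime_pairs b"
  shows "popcorn_point b (p, j) \<in> cube (1 / real b, 1 / (2 * real b ^ 2)) (1 / real b ^ 2)"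
proof -
  define y where "y = snd (popcorn_point b (p, j))"
  have y: "y = 1 / (real p * real b - real j)"
    by (simp add: y_def popcorn_point_def)
  have q0: "0 < real p * real b - real j"
    using denominator_bounds(1)[OF pj] b by (smt (verit) of_nat_0_less_iff zero_less_power)
  have lo: "1 / (2 * real b ^ 2) \<le> y" and hi: "y \<le> 1 / real b ^ 2" and y0: "0 \<le> y"
    using denominator_bounds[OF pj] q0 b unfolding y by (auto intro!: frac_le)
  have "real j / real b \<le> 1"
    using pj b by (auto simp: coprime_pairs_def)
  then have "real j / real b * y \<le> y"
    using y0 by (intro mult_left_le_one_le) auto
  moreover have "0 \<le> real j / real b * y"
    using y0 by simp
  moreover have "0 \<le> 1 / (2 * real b ^ 2)"
    by simp
  moreover have eq: "popcorn_point b (p, j) = (1 / real b + real j / real b * y, y)"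
    using popcorn_point_fst[OF b pj] by (simp add: y_def prod_eq_iff)
  ultimately show ?thesis
    using lo hi unfolding eq mem_cube_prod_iff by linarith
qed

text \<open>The indices are recovered in two stages: both coordinates together determine
  \<open>j\<close>, and then the height determines \<open>p\<close> along the line belonging to
  \<open>j\<close>. In each stage two integers are shown to differ by at most 4/5.\<close>

lemma popcorn_point_separated:
  assumes b: "0 < b" and pj: "(p, j) \<in> coprime_pairs b" and pj': "(p', j') \<in> coprime_pairs b"
    and cube: "popcorn_point b (p, j) \<in> cube z (1 / (5 * real b ^ 3))"
    and cube': "popcorn_point b (p', j') \<in> cube z (1 / (5 * real b ^ 3))"
  shows "(p, j) = (p', j')"
proof -
  define r where "r = 1 / (5 * real b ^ 3)"
  define q where "q = real p * real b - real j"
  define q' where "q' = real p' * real b - real j'"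
  note q = denominator_bounds[OF pj, folded q_def]
  note q' = denominator_bounds[OF pj', folded q'_def]
  have b2: "0 < real b ^ 2" using b by simp
  have q0: "0 < q" and q0': "0 < q'"
    using q q' b2 by linarith+
  have r0: "0 < r" using b by (simp add: r_def)
  have y: "\<bar>1 / q - 1 / q'\<bar> \<le> r"
    and x: "\<bar>(1 / real b + real j / real b * (1 / q)) - (1 / real b + real j' / real b * (1 / q'))\<bar> \<le> r"
  proof -
    have eq: "popcorn_point b (p, j) = (1 / real b + real j / real b * (1 / q), 1 / q)"
      "popcorn_point b (p', j') = (1 / real b + real j' / real b * (1 / q'), 1 / q')"
      using popcorn_point_fst[OF b pj] popcorn_point_fst[OF b pj']
      by (auto simp: prod_eq_iff) (auto simp: popcorn_point_def q_def q'_def)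
    obtain z1 z2 where "z = (z1, z2)" by (cases z)
    then show "\<bar>1 / q - 1 / q'\<bar> \<le> r"
      "\<bar>(1 / real b + real j / real b * (1 / q)) - (1 / real b + real j' / real b * (1 / q'))\<bar> \<le> r"
      using cube cube' unfolding eq r_def[symmetric] by (auto simp only: mem_cube_prod_iff abs_le_iff)
  qed
  have "real j' \<le> real b"
    using pj' by (simp add: coprime_pairs_def)
  \<comment> \<open>If \<open>x\<close> is the abscissa, then \<open>j = q * (b * x - 1)\<close>.
    The difference is split into an abscissa part and a height part, each at most
    \<open>b * r\<close>; with \<open>q \<le> 2 * b^2\<close> the total is
    \<open>4 * b^3 * r\<close>, and the factor 5 in \<open>r\<close> brings it below 1.\<close>
  have "real j - real j' = q * (real b * ((1 / real b + real j / real b * (1 / q)) -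
      (1 / real b + real j' / real b * (1 / q'))) - real j' * (1 / q - 1 / q'))"
    using b q0 q0' by (simp add: field_simps)
  also have "\<bar>\<dots>\<bar> \<le> (2 * real b ^ 2) * (real b * r + real b * r)"
    unfolding abs_mult
  proof (intro mult_mono order_trans[OF abs_triangle_ineq4] add_mono)
    show "\<bar>q\<bar> \<le> 2 * real b ^ 2" using q q0 by simp
  qed (use x y \<open>real j' \<le> real b\<close> r0 in \<open>auto simp: abs_mult intro!: mult_mono\<close>)
  also have "\<dots> = 4/5"
    using b by (simp add: r_def field_simps eval_nat_numeral)
  finally have j: "j = j'" by linarith
  \<comment> \<open>On a common line \<open>q - q' = b * (p - p')\<close>, and \<open>q - q'\<close>
    is \<open>q * q'\<close> times the difference of the reciprocals.\<close>
  have "real b * (real p - real p') = q * q' * (1 / q' - 1 / q)"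
    using q0 q0' by (simp add: field_simps) (simp add: q_def q'_def j algebra_simps)
  also have "\<bar>\<dots>\<bar> \<le> (2 * real b ^ 2) * (2 * real b ^ 2) * r"
    unfolding abs_mult using q q' q0 q0' y r0 by (intro mult_mono) (auto simp: abs_minus_commute)
  also have "\<dots> = real b * (4/5)"
    using b by (simp add: r_def field_simps eval_nat_numeral)
  finally have "\<bar>real p - real p'\<bar> \<le> 4/5"
    using b by (simp add: abs_mult)
  then have "p = p'" by linarith
  with j show ?thesis by simp
qed

lemma covering_number_popcorn_ge:
  assumes b: "48 \<le> b" and X: "popcorn_graph \<subseteq> X"
  shows "real b ^ 2 / 8 \<le> real (covering_number (1 / (5 * real b ^ 3))
           (cube (1 / real b, 1 / (2 * real b ^ 2)) (1 / real b ^ 2) \<inter> X))"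
proof -
  let ?r = "1 / (5 * real b ^ 3)"
  let ?A = "popcorn_point b ` coprime_pairs b"
  have b0: "0 < b" and b3: "3 \<le> b" and r0: "0 < ?r"
    using b by auto
  have "inj_on (popcorn_point b) (coprime_pairs b)"
  proof (rule inj_onI, clarify)
    fix p j p' j'
    assume *: "(p, j) \<in> coprime_pairs b" "(p', j') \<in> coprime_pairs b"
      "popcorn_point b (p, j) = popcorn_point b (p', j')"
    have "popcorn_point b (p, j) \<in> cube (popcorn_point b (p, j)) ?r"
      using r0 by (simp add: mem_cube_iff)
    with * show "p = p' \<and> j = j'"
      using popcorn_point_separated[OF b0 *(1,2)] by auto
  qed
  then have card: "card ?A = card (coprime_pairs b)"
    by (rule card_image)
  have "card ?A \<le> covering_number ?r (cube (1 / real b, 1 / (2 * real b ^ 2)) (1 / real b ^ 2) \<inter> X)"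
  proof (rule card_le_covering_number_cube[OF r0])
    show "?A \<subseteq> cube (1 / real b, 1 / (2 * real b ^ 2)) (1 / real b ^ 2) \<inter> X"
      using popcorn_point_in_cube[OF b0] popcorn_point_in_graph[OF b3] X by auto
    show "u = v" if "u \<in> ?A" "v \<in> ?A" "u \<in> cube y ?r" "v \<in> cube y ?r" for y u v
      using that popcorn_point_separated[OF b0] by (auto; metis)
  qed
  then show ?thesis
    using card_coprime_pairs[OF b] card by linarith
qed

section \<open>From the grid to the dimensions\<close>

text \<open>The bound is assumed only at the special squares, so that both dimensions can use it.
  There \<open>R / r = 5 * b\<close>, and the count \<open>b^2 / 8\<close> becomes
  \<open>(5 * b)^2 \<le> 200 * c * (5 * b) powr s\<close>, which fails for large \<open>b\<close> if
  \<open>s < 2\<close>.\<close>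

lemma exponent_ge_2:
  assumes X: "popcorn_graph \<subseteq> X"
    and bound: "\<And>b. 48 \<le> b \<Longrightarrow> real (covering_number (1 / (5 * real b ^ 3))
           (cube (1 / real b, 1 / (2 * real b ^ 2)) (1 / real b ^ 2) \<inter> X))
           \<le> c * (1 / real b ^ 2 / (1 / (5 * real b ^ 3))) powr s"
  shows "2 \<le> s"
proof (rule ccontr)
  assume "\<not> 2 \<le> s"
  \<comment> \<open>The factor 200 is \<open>8 * 5^2\<close>. The maximum with 1 keeps
    \<open>C\<close> positive whatever the sign of \<open>c\<close>, so that
    \<open>powr (2 - s)\<close> undoes \<open>powr (1 / (2 - s))\<close>.\<close>
  define C where "C = max 1 (200 * c)"
  obtain b :: nat where "max 48 (C powr (1 / (2 - s))) < real b"
    using reals_Archimedean2 by blast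
  then have b: "48 \<le> b" and "C powr (1 / (2 - s)) < 5 * real b"
    by auto
  then have "(C powr (1 / (2 - s))) powr (2 - s) < (5 * real b) powr (2 - s)"
    using \<open>\<not> 2 \<le> s\<close> by (intro powr_less_mono2) auto
  then have C: "200 * c < (5 * real b) powr (2 - s)"
    using \<open>\<not> 2 \<le> s\<close> by (simp add: powr_powr C_def)
  have "real b ^ 2 / 8 \<le> c * (5 * real b) powr s"
    using order_trans[OF covering_number_popcorn_ge[OF b X] bound[OF b]] b
    by (simp add: power2_eq_square power3_eq_cube)
  then have "(5 * real b) ^ 2 \<le> 200 * c * (5 * real b) powr s"
    by (simp add: power_mult_distrib)
  also have "\<dots> < (5 * real b) powr (2 - s) * (5 * real b) powr s"
    using b C by (intro mult_strict_right_mono) auto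
  also have "\<dots> = (5 * real b) ^ 2"
    using b by (simp flip: powr_add)
  finally show False by simp
qed

lemma assouad_dim_popcorn:
  assumes "popcorn_graph \<subseteq> X"
  shows "assouad_dim X = 2"
  unfolding assouad_dim_def
proof (rule cInf_eq_minimum)
  \<comment> \<open>The constant 4 is \<open>2 ^ DIM\<close> in the plane.\<close>
  show "2 \<in> {s. 0 \<le> s \<and> (\<exists>c>0. \<forall>r R x. 0 < r \<and> r < R \<longrightarrow>
            real (covering_number r (cube x R \<inter> X)) \<le> c * (R / r) powr s)}"
    using covering_number_cube_le[of _ _ _ X] by (auto intro!: exI[of _ 4])
next
  fix s assume "s \<in> {s. 0 \<le> s \<and> (\<exists>c>0. \<forall>r R x. 0 < r \<and> r < R \<longrightarrow>
            real (covering_number r (cube x R \<inter> X)) \<le> c * (R / r) powr s)}"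
  then obtain c where c: "\<And>r R x. 0 < r \<Longrightarrow> r < R \<Longrightarrow>
      real (covering_number r (cube x R \<inter> X)) \<le> c * (R / r) powr s"
    by blast
  show "2 \<le> s"
  proof (rule exponent_ge_2[OF assms], rule c)
    fix b :: nat assume "48 \<le> b"
    then show "0 < 1 / (5 * real b ^ 3)" "1 / (5 * real b ^ 3) < 1 / real b ^ 2"
      by (auto simp: field_simps power2_eq_square power3_eq_cube)
  qed
qed

lemma quasi_assouad_h_popcorn:
  assumes "popcorn_graph \<subseteq> X" and \<theta>: "2/3 \<le> \<theta>" "\<theta> < 1"
  shows "quasi_assouad_h X \<theta> = 2"
  unfolding quasi_assouad_h_def
proof (rule cInf_eq_minimum)
  \<comment> \<open>\<open>covering_number_cube_le\<close> requires \<open>r < R\<close>; this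
    follows from \<open>1 / \<theta> > 1\<close> and \<open>R < 1\<close>.\<close>
  have less: "r < R" if "0 < R" "R < 1" "r \<le> R powr (1 / \<theta>)" for r R :: real
  proof -
    have "R powr (1 / \<theta>) < R powr 1"
      using that \<theta> by (intro powr_less_mono') auto
    then show ?thesis
      using that by simp
  qed
  show "2 \<in> {s. 0 \<le> s \<and> (\<exists>c>0. \<forall>r R x. 0 < R \<and> R < 1 \<and> 0 < r \<and> r \<le> R powr (1 / \<theta>) \<longrightarrow>
            real (covering_number r (cube x R \<inter> X)) \<le> c * (R / r) powr s)}"
    using covering_number_cube_le[of _ _ _ X] less by (auto intro!: exI[of _ 4])
next
  fix s assume "s \<in> {s. 0 \<le> s \<and> (\<exists>c>0. \<forall>r R x. 0 < R \<and> R < 1 \<and> 0 < r \<and> r \<le> R powr (1 / \<theta>) \<longrightarrow>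
            real (covering_number r (cube x R \<inter> X)) \<le> c * (R / r) powr s)}"
  then obtain c where c: "\<And>r R x. 0 < R \<Longrightarrow> R < 1 \<Longrightarrow> 0 < r \<Longrightarrow> r \<le> R powr (1 / \<theta>) \<Longrightarrow>
      real (covering_number r (cube x R \<inter> X)) \<le> c * (R / r) powr s"
    by blast
  show "2 \<le> s"
  proof (rule exponent_ge_2[OF assms(1)], rule c)
    fix b :: nat assume b: "48 \<le> b"
    then show R: "0 < 1 / real b ^ 2" "1 / real b ^ 2 < 1" "0 < 1 / (5 * real b ^ 3)"
      by (auto simp: one_less_power)
    \<comment> \<open>This is where 2/3 enters: \<open>b^(-3)\<close> is the power 3/2 of
      \<open>R = b^(-2)\<close>, and \<open>1 / \<theta> \<le> 3/2\<close> with \<open>R < 1\<close>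
      makes \<open>R powr (1 / \<theta>)\<close> at least as large.\<close>
    have "1 / (5 * real b ^ 3) \<le> 1 / real b ^ 3"
      using b by (simp add: field_simps)
    also have "\<dots> = (1 / real b ^ 2) powr (3/2)"
      using b by (simp add: powr_divide powr_powr flip: powr_numeral)
    also have "\<dots> \<le> (1 / real b ^ 2) powr (1 / \<theta>)"
      using R \<theta> by (intro powr_mono') (auto simp: field_simps)
    finally show "1 / (5 * real b ^ 3) \<le> (1 / real b ^ 2) powr (1 / \<theta>)" .
  qed
qed

text \<open>The left limit at 1 only sees \<open>\<theta>\<close> in \<open>(2/3, 1)\<close>, where
  \<open>quasi_assouad_h X\<close> is constantly 2.\<close>

lemma quasi_assouad_dim_popcorn:
  assumes "popcorn_graph \<subseteq> X"
  shows "quasi_assouad_dim X = 2"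
proof -
  have "eventually (\<lambda>\<theta>::real. \<theta> \<in> {2/3<..<1}) (at_left 1)"
    by (rule eventually_at_left_real) simp
  then have "eventually (\<lambda>\<theta>. quasi_assouad_h X \<theta> = 2) (at_left 1)"
    by eventually_elim (auto intro: quasi_assouad_h_popcorn[OF assms])
  then have "(quasi_assouad_h X \<longlongrightarrow> 2) (at_left 1)"
    by (rule tendsto_eventually)
  then show ?thesis
    unfolding quasi_assouad_dim_def by (intro tendsto_Lim) simp_all
qed

text \<open>The dimension results hold for every superset of the graph; this inclusion brings the
  full set under them.\<close>

lemma popcorn_graph_subset: "popcorn_graph \<subseteq> full_popcorn_set"
proof
  fix z assume "z \<in> popcorn_graph"
  then obtain x where x: "x \<in> {0..1}" "z = (x, popcorn x)"
    by (auto simp: popcorn_graph_def)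
  show "z \<in> full_popcorn_set"
  proof (cases "\<exists>p q. popcorn_rep x p q")
    case True
    then obtain p q where pq: "popcorn_rep x p q" by blast
    then have "z = (real p / real q, 1 / real q)" "0 < p" "0 < q" "p < q"
      using x popcorn_eq[OF pq] by (auto simp: popcorn_rep_def)
    then show ?thesis
      unfolding full_popcorn_set_def by blast
  next
    case False
    then show ?thesis
      using x by (simp add: full_popcorn_set_def popcorn_def)
  qed
qed

theorem corollary3p1:
  "quasi_assouad_dim popcorn_graph = 2 \<and> quasi_assouad_dim full_popcorn_set = 2 \<and>
   assouad_dim popcorn_graph = 2 \<and> assouad_dim full_popcorn_set = 2"
  by (simp add: quasi_assouad_dim_popcorn assouad_dim_popcorn popcorn_graph_subset)

end
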